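(* Let $i:H\hookrightarrow G$ be a localization (an injective homomorphism) between two non-abelian finite simple groups. Then $i$ extends to a monomorphism $j:\mathrm{Aut}(H)\hookrightarrow\mathrm{Aut}(G)$. Assume that $j$ induces an isomorphism $\mathrm{Out}(H)\cong\mathrm{Out}(G)$. Then $j:\mathrm{Aut}(H)\hookrightarrow\mathrm{Aut}(G)$ is a localization.
   Context: A group homomorphism $\varphi:A\to B$ is called a localization if precomposition with $\varphi$ induces a bijection $\varphi^*:\mathrm{Hom}(B,B)\to\mathrm{Hom}(A,B)$, $f\mapsto f\circ\varphi$. A non-abelian simple group $G$ is identified with the subgroup $\mathrm{Inn}(G)$ of $\mathrm{Aut}(G)$ via $g\mapsto c_g$, where $c_g(x)=gxg^{-1}$, and $\mathrm{Out}(G)=\mathrm{Aut}(G)/G$. A homomorphism $j:\mathrm{Aut}(H)\to\mathrm{Aut}(G)$ extends $i:H\to G$ if $j(c_h)=c_{i(h)}$ for all $h\in H$; such a $j$ sends $H$ into $G$ and hence induces a homomorphism $\mathrm{Out}(H)\to\mathrm{Out}(G)$. *)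

theory Defs
  imports "HOL-Algebra.Bij" "HOL-Algebra.SimpleGroups"
begin

text \<open>
  The members of \<^term>\<open>hom A B\<close> are arbitrary outside \<^term>\<open>carrier A\<close>.  A homomorphism of groups
  in the mathematical sense is represented by exactly one extensional member; without this
  normalisation precomposition could not be injective.
\<close>

definition Homs :: "('a, 'm) monoid_scheme \<Rightarrow> ('b, 'n) monoid_scheme \<Rightarrow> ('a \<Rightarrow> 'b) set"
  where "Homs A B = hom A B \<inter> extensional (carrier A)"

definition localization ::
    "('a, 'm) monoid_scheme \<Rightarrow> ('b, 'n) monoid_scheme \<Rightarrow> ('a \<Rightarrow> 'b) \<Rightarrow> bool"
  where "localization A B \<phi> \<longleftrightarrow>
    \<phi> \<in> hom A B \<and> bij_betw (\<lambda>f. compose (carrier A) f \<phi>) (Homs B B) (Homs A B)"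

definition inner_aut :: "('a, 'm) monoid_scheme \<Rightarrow> 'a \<Rightarrow> 'a \<Rightarrow> 'a"
  where "inner_aut G g = (\<lambda>x \<in> carrier G. g \<otimes>\<^bsub>G\<^esub> x \<otimes>\<^bsub>G\<^esub> inv\<^bsub>G\<^esub> g)"

definition Inn :: "('a, 'm) monoid_scheme \<Rightarrow> ('a \<Rightarrow> 'a) set"
  where "Inn G = inner_aut G ` carrier G"

definition Out :: "('a, 'm) monoid_scheme \<Rightarrow> ('a \<Rightarrow> 'a) set monoid"
  where "Out G = AutoGroup G Mod Inn G"

definition extends_to_Aut ::
    "('a, 'm) monoid_scheme \<Rightarrow> ('b, 'n) monoid_scheme \<Rightarrow> ('a \<Rightarrow> 'b) \<Rightarrow>
      (('a \<Rightarrow> 'a) \<Rightarrow> ('b \<Rightarrow> 'b)) \<Rightarrow> bool"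
  where "extends_to_Aut H G i j \<longleftrightarrow>
    (\<forall>h \<in> carrier H. j (inner_aut H h) = inner_aut G (i h))"

text \<open>
  The map on cosets of inner automorphisms induced by \<open>j\<close>.  It sends the coset of \<open>\<alpha>\<close> to the coset
  of \<open>j \<alpha>\<close>; that this is independent of \<open>\<alpha>\<close> when \<open>j\<close> extends a homomorphism is the content of
  \<open>Out_map_coset\<close> below.
\<close>

definition Out_map ::
    "('b, 'n) monoid_scheme \<Rightarrow> (('a \<Rightarrow> 'a) \<Rightarrow> ('b \<Rightarrow> 'b)) \<Rightarrow>
      ('a \<Rightarrow> 'a) set \<Rightarrow> ('b \<Rightarrow> 'b) set"
  where "Out_map G j X = the_elem ((\<lambda>\<alpha>. Inn G #>\<^bsub>AutoGroup G\<^esub> j \<alpha>) ` X)"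

lemma inner_aut_hom:
  fixes G (structure)
  assumes "group G"
  shows "inner_aut G \<in> hom G (AutoGroup G)"
proof -
  interpret group G by fact
  have bij: "inner_aut G g \<in> Bij (carrier G)" if g: "g \<in> carrier G" for g
    unfolding Bij_def inner_aut_def
  proof (intro IntI restrict_extensional CollectI bij_betw_byWitness[where f' = "\<lambda>x. inv g \<otimes> x \<otimes> g"])
    show "\<forall>x\<in>carrier G. inv g \<otimes> (\<lambda>x\<in>carrier G. g \<otimes> x \<otimes> inv g) x \<otimes> g = x"
      using g by (simp add: m_assoc) (simp add: m_assoc[symmetric])
    show "\<forall>x\<in>carrier G. (\<lambda>x\<in>carrier G. g \<otimes> x \<otimes> inv g) (inv g \<otimes> x \<otimes> g) = x"
      using g by (simp add: m_assoc) (simp add: m_assoc[symmetric])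
  qed (use g in auto)
  have aut: "inner_aut G g \<in> auto G" if g: "g \<in> carrier G" for g
  proof -
    have "g \<otimes> (x \<otimes> y) \<otimes> inv g = g \<otimes> x \<otimes> inv g \<otimes> (g \<otimes> y \<otimes> inv g)"
      if "x \<in> carrier G" "y \<in> carrier G" for x y
      using g that by (simp add: m_assoc inv_solve_left)
    then show ?thesis
      using g bij[OF g] by (auto simp: auto_def hom_def inner_aut_def)
  qed
  have "inner_aut G (g \<otimes> h) = compose (carrier G) (inner_aut G g) (inner_aut G h)"
    if "g \<in> carrier G" "h \<in> carrier G" for g h
    using that by (auto simp: inner_aut_def compose_def fun_eq_iff m_assoc inv_mult_group)
  then show ?thesis
    using aut bij by (auto simp: hom_def AutoGroup_def BijGroup_def)
qed

lemma Inn_subgroup: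
  assumes "group G"
  shows "subgroup (Inn G) (AutoGroup G)"
proof -
  interpret group_hom G "AutoGroup G" "inner_aut G"
    using assms by (simp add: group_hom_def group_hom_axioms_def inner_aut_hom group.AutoGroup)
  show ?thesis
    unfolding Inn_def by (rule img_is_subgroup)
qed

lemma Out_map_coset:
  assumes "group H" "group G" "i \<in> hom H G"
    and j: "j \<in> hom (AutoGroup H) (AutoGroup G)" "extends_to_Aut H G i j"
    and \<alpha>: "\<alpha> \<in> carrier (AutoGroup H)"
  shows "Out_map G j (Inn H #>\<^bsub>AutoGroup H\<^esub> \<alpha>) = Inn G #>\<^bsub>AutoGroup G\<^esub> j \<alpha>"
proof -
  interpret AG: group "AutoGroup G" using assms by (simp add: group.AutoGroup)
  interpret AH: group "AutoGroup H" using assms by (simp add: group.AutoGroup)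
  have j\<alpha>: "j \<alpha> \<in> carrier (AutoGroup G)" using j(1) \<alpha> by (rule hom_in_carrier)
  have "Inn G #>\<^bsub>AutoGroup G\<^esub> j \<beta> = Inn G #>\<^bsub>AutoGroup G\<^esub> j \<alpha>"
    if "\<beta> \<in> Inn H #>\<^bsub>AutoGroup H\<^esub> \<alpha>" for \<beta>
  proof -
    from that obtain h where h: "h \<in> carrier H" "\<beta> = inner_aut H h \<otimes>\<^bsub>AutoGroup H\<^esub> \<alpha>"
      by (auto simp: r_coset_def Inn_def)
    have "inner_aut H h \<in> carrier (AutoGroup H)"
      using inner_aut_hom[OF assms(1)] h(1) by (rule hom_in_carrier)
    then have "j \<beta> = inner_aut G (i h) \<otimes>\<^bsub>AutoGroup G\<^esub> j \<alpha>"
      using h j \<alpha> by (simp add: hom_mult extends_to_Aut_def)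
    moreover have "inner_aut G (i h) \<in> Inn G"
      using h assms(3) by (auto simp: Inn_def hom_def)
    ultimately have "j \<beta> \<in> Inn G #>\<^bsub>AutoGroup G\<^esub> j \<alpha>"
      by (auto simp: r_coset_def)
    then show ?thesis
      using AG.repr_independence[OF _ j\<alpha> Inn_subgroup[OF assms(2)]] by simp
  qed
  moreover have "\<alpha> \<in> Inn H #>\<^bsub>AutoGroup H\<^esub> \<alpha>"
    using AH.rcos_self[OF \<alpha> Inn_subgroup[OF assms(1)]] .
  ultimately have "(\<lambda>\<beta>. Inn G #>\<^bsub>AutoGroup G\<^esub> j \<beta>) ` (Inn H #>\<^bsub>AutoGroup H\<^esub> \<alpha>) =
      {Inn G #>\<^bsub>AutoGroup G\<^esub> j \<alpha>}"
    by blast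
  then show ?thesis by (simp add: Out_map_def)
qed

end

theory Submission
  imports Defs
begin

text \<open>
  For a localization \<open>i : H \<rightarrow> G\<close> as in the theorem, every nontrivial homomorphism \<open>H \<rightarrow> G\<close> is injective
  and is \<open>i\<close> followed by a unique automorphism of \<open>G\<close>.  Applied to the homomorphisms \<open>i \<circ> \<alpha>\<close> with \<open>\<alpha>\<close>
  in \<open>Aut H\<close>, this produces the extension \<open>j\<close> (\<open>ex_AutoGroup_extension\<close>).  It also shows that an
  automorphism of \<open>G\<close> commuting with all conjugations by elements of some copy \<open>\<phi> (i H)\<close> is the identity
  (\<open>centralizer_trivial\<close>); hence a homomorphism into \<open>Aut G\<close> mapping a normal subgroup onto a
  group that contains such a copy is determined by its restriction to that subgroup (\<open>homs_agreeing_on_normal_eq\<close>).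

  A nontrivial normal subgroup of the automorphism group of a simple group contains the inner
  automorphisms (\<open>normal_AutoGroup_cases\<close>).  So a homomorphism \<open>f : Aut H \<rightarrow> Aut G\<close> either kills
  \<open>Inn H\<close> or is injective, and it has to be shown that \<open>f\<close> factors uniquely through \<open>j\<close>.

  If \<open>f\<close> kills \<open>Inn H\<close>, it factors through \<open>Out H \<cong> Out G\<close> and thus extends along \<open>j\<close>.  Any
  extension kills \<open>i H\<close>, hence kills \<open>Inn G\<close>, and is determined by its values on representatives
  \<open>j \<alpha>\<close> of the cosets of \<open>Inn G\<close>.

  If \<open>f\<close> is injective, then \<open>f\<close> maps \<open>Inn H\<close> into \<open>Inn G\<close>: otherwise the preimage of \<open>Inn G\<close> is
  trivial and \<open>Aut H\<close> embeds into \<open>Out G\<close>, whose order is that of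
  \<open>Out H\<close> and hence less than that of \<open>Aut H\<close> (\<open>inj_hom_maps_Inn\<close>).  This counting argument makes the solvability of \<open>Out G\<close>, known only through the
  classification of the finite simple groups, unnecessary.  So \<open>f\<close> restricts to \<open>\<phi> \<circ> i\<close> on \<open>H\<close> for an
  automorphism \<open>\<phi>\<close> of \<open>G\<close>.  Conjugation by \<open>\<phi>\<close> in \<open>Aut G\<close> extends \<open>f\<close> on \<open>Inn H\<close>, hence on \<open>Aut H\<close>.
  Conversely any extension preserves \<open>Inn G\<close>, acts on it as \<open>\<phi>\<close> because \<open>i\<close> is a localization, and
  therefore is conjugation by \<open>\<phi>\<close>.
\<close>

section \<open>Homomorphisms and normal subgroups\<close>

lemma (in group_hom) normal_vimage:
  assumes "N \<lhd> H"
  shows "{x \<in> carrier G. h x \<in> N} \<lhd> G"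
proof -
  interpret N: normal N H by fact
  have "subgroup {x \<in> carrier G. h x \<in> N} G"
    by unfold_locales auto
  then show ?thesis
    by (auto simp: G.normal_inv_iff N.inv_op_closed2)
qed

text \<open>
  Two homomorphisms that agree on a normal subgroup differ by elements centralizing the image of that
  subgroup: for \<open>m\<close> in it, \<open>f a * f m * (f a)\<^sup>-\<^sup>1 = f (a * m * a\<^sup>-\<^sup>1)\<close> is already determined by \<open>f\<close> on the subgroup.
\<close>
lemma homs_agreeing_on_normal_eq:
  assumes "f \<in> hom A B" "f' \<in> hom A B" "M \<lhd> A" "group B"
    and agree: "\<And>m. m \<in> M \<Longrightarrow> f m = f' m"
    and centralizer: "\<And>b. b \<in> carrier B \<Longrightarrow> (\<And>m. m \<in> M \<Longrightarrow> b \<otimes>\<^bsub>B\<^esub> f m = f m \<otimes>\<^bsub>B\<^esub> b) \<Longrightarrow> b = \<one>\<^bsub>B\<^esub>"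
    and a: "a \<in> carrier A"
  shows "f a = f' a"
proof -
  interpret M: normal M A by fact
  interpret f: group_hom A B f using assms by (simp add: group_hom_def group_hom_axioms_def M.is_group)
  interpret f': group_hom A B f' using assms by (simp add: group_hom_def group_hom_axioms_def M.is_group)
  have "inv\<^bsub>B\<^esub> f' a \<otimes>\<^bsub>B\<^esub> f a = \<one>\<^bsub>B\<^esub>"
  proof (rule centralizer)
    fix m assume m: "m \<in> M"
    have mA: "m \<in> carrier A" using m M.subset by blast
    define n where "n = a \<otimes>\<^bsub>A\<^esub> m \<otimes>\<^bsub>A\<^esub> inv\<^bsub>A\<^esub> a"
    have n: "n \<in> M" unfolding n_def using M.inv_op_closed2[OF a m] .
    have nA: "n \<in> carrier A" using n M.subset by blast
    have na: "a \<otimes>\<^bsub>A\<^esub> m = n \<otimes>\<^bsub>A\<^esub> a" unfolding n_def using a mA by (simp add: M.m_assoc)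
    have "f a \<otimes>\<^bsub>B\<^esub> f m = f n \<otimes>\<^bsub>B\<^esub> f a"
      using arg_cong[OF na, of f] a mA nA by simp
    moreover have "f' a \<otimes>\<^bsub>B\<^esub> f m = f n \<otimes>\<^bsub>B\<^esub> f' a"
      using arg_cong[OF na, of f'] a mA nA agree[OF m] agree[OF n] by simp
    then have "inv\<^bsub>B\<^esub> f' a \<otimes>\<^bsub>B\<^esub> f n = f m \<otimes>\<^bsub>B\<^esub> inv\<^bsub>B\<^esub> f' a"
      using a mA nA by (metis f'.hom_closed f.hom_closed f.H.inv_closed f.H.inv_solve_left f.H.inv_solve_right f.H.m_assoc f.H.m_closed)
    ultimately show "inv\<^bsub>B\<^esub> f' a \<otimes>\<^bsub>B\<^esub> f a \<otimes>\<^bsub>B\<^esub> f m = f m \<otimes>\<^bsub>B\<^esub> (inv\<^bsub>B\<^esub> f' a \<otimes>\<^bsub>B\<^esub> f a)"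
      using a mA nA by (simp add: f.H.m_assoc) (simp flip: f.H.m_assoc)
  qed (use a in auto)
  then show ?thesis
    using a by (metis f'.hom_closed f.hom_closed f.H.inv_closed f.H.inv_equality f.H.inv_inv)
qed

section \<open>Automorphism groups of simple groups\<close>

lemma carrier_AutoGroup: "carrier (AutoGroup G) = auto G"
  by (simp add: AutoGroup_def)

lemma one_AutoGroup: "\<one>\<^bsub>AutoGroup G\<^esub> = (\<lambda>x \<in> carrier G. x)"
  by (simp add: AutoGroup_def BijGroup_def)

lemma mult_AutoGroup:
  "\<alpha> \<in> carrier (AutoGroup G) \<Longrightarrow> \<beta> \<in> carrier (AutoGroup G) \<Longrightarrow> \<alpha> \<otimes>\<^bsub>AutoGroup G\<^esub> \<beta> = compose (carrier G) \<alpha> \<beta>"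
  by (simp add: carrier_AutoGroup) (simp add: AutoGroup_def BijGroup_def auto_def)

lemma autoD:
  assumes "\<alpha> \<in> carrier (AutoGroup G)"
  shows "\<alpha> \<in> hom G G" "\<alpha> \<in> extensional (carrier G)" "inj_on \<alpha> (carrier G)" "\<alpha> ` carrier G = carrier G"
  using assms by (auto simp: carrier_AutoGroup auto_def Bij_def bij_betw_def)

lemma finite_auto:
  assumes "finite (carrier G)"
  shows "finite (carrier (AutoGroup G))"
proof (rule finite_subset)
  show "carrier (AutoGroup G) \<subseteq> carrier G \<rightarrow>\<^sub>E carrier G"
    by (auto simp: carrier_AutoGroup auto_def PiE_def dest: Bij_imp_extensional Bij_imp_funcset)
  show "finite (carrier G \<rightarrow>\<^sub>E carrier G)" using assms by (simp add: finite_PiE)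
qed

context group
begin

lemma auto_mult_inner_aut:
  assumes \<alpha>: "\<alpha> \<in> carrier (AutoGroup G)" and g: "g \<in> carrier G"
  shows "\<alpha> \<otimes>\<^bsub>AutoGroup G\<^esub> inner_aut G g = inner_aut G (\<alpha> g) \<otimes>\<^bsub>AutoGroup G\<^esub> \<alpha>"
proof -
  interpret \<alpha>: group_hom G G \<alpha>
    using autoD(1)[OF \<alpha>] by unfold_locales
  have inn: "inner_aut G x \<in> carrier (AutoGroup G)" if "x \<in> carrier G" for x
    using hom_in_carrier[OF inner_aut_hom[OF is_group] that] .
  show ?thesis
    using g inn \<alpha> by (auto simp: mult_AutoGroup compose_def inner_aut_def fun_eq_iff)
qed

lemma inner_aut_mem: "g \<in> carrier G \<Longrightarrow> inner_aut G g \<in> carrier (AutoGroup G)"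
  by (rule hom_in_carrier[OF inner_aut_hom[OF is_group]])

lemma group_hom_inner_aut: "group_hom G (AutoGroup G) (inner_aut G)"
  using AutoGroup inner_aut_hom[OF is_group] by (simp add: group_hom_def group_hom_axioms_def is_group)

lemma Inn_normal: "Inn G \<lhd> AutoGroup G"
proof -
  interpret A: group "AutoGroup G" by (rule AutoGroup)
  have "\<alpha> \<otimes>\<^bsub>AutoGroup G\<^esub> inner_aut G g \<otimes>\<^bsub>AutoGroup G\<^esub> inv\<^bsub>AutoGroup G\<^esub> \<alpha> \<in> Inn G"
    if "\<alpha> \<in> carrier (AutoGroup G)" "g \<in> carrier G" for \<alpha> g
  proof -
    have \<alpha>g: "\<alpha> g \<in> carrier G" using autoD(4)[OF that(1)] that(2) by blast
    have "\<alpha> \<otimes>\<^bsub>AutoGroup G\<^esub> inner_aut G g \<otimes>\<^bsub>AutoGroup G\<^esub> inv\<^bsub>AutoGroup G\<^esub> \<alpha> = inner_aut G (\<alpha> g)"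
      using that \<alpha>g by (simp add: auto_mult_inner_aut A.m_assoc inner_aut_mem)
    then show ?thesis using \<alpha>g by (auto simp: Inn_def)
  qed
  then show ?thesis
    using Inn_subgroup[OF is_group] by (auto simp: A.normal_inv_iff Inn_def)
qed

lemma inner_aut_trivial_imp_central:
  assumes "g \<in> carrier G" "inner_aut G g = (\<lambda>x \<in> carrier G. x)" "x \<in> carrier G"
  shows "g \<otimes> x = x \<otimes> g"
proof -
  have "g \<otimes> x \<otimes> inv g = x" using assms by (auto simp: inner_aut_def fun_eq_iff split: if_splits)
  then show ?thesis using assms by (metis inv_closed inv_solve_right m_closed)
qed

end

context simple_group
begin

lemma inj_on_hom_or_trivial:
  assumes "f \<in> hom G K" "group K"
  shows "inj_on f (carrier G) \<or> (\<forall>x \<in> carrier G. f x = \<one>\<^bsub>K\<^esub>)"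
proof -
  interpret f: group_hom G K f using assms by (simp add: group_hom_def group_hom_axioms_def is_group)
  from no_real_normal_subgroup[OF f.normal_kernel] show ?thesis
    by (auto simp: f.inj_iff_trivial_ker kernel_def)
qed

lemma inner_aut_inj:
  assumes "\<not> comm_group G"
  shows "inj_on (inner_aut G) (carrier G)"
proof (rule ccontr)
  assume "\<not> ?thesis"
  then have "\<forall>x \<in> carrier G. inner_aut G x = \<one>\<^bsub>AutoGroup G\<^esub>"
    using inj_on_hom_or_trivial[OF inner_aut_hom[OF is_group] AutoGroup] by blast
  then have "comm_group G"
    using inner_aut_trivial_imp_central by (intro group_comm_groupI) (simp add: one_AutoGroup)
  with assms show False by contradiction
qed

text \<open>
  If a normal subgroup \<open>K\<close> of the automorphism group meets \<open>Inn G\<close> trivially, then for \<open>\<alpha>\<close> in \<open>K\<close> the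
  commutator of \<open>\<alpha>\<close> and conjugation by \<open>g\<close>, which is conjugation by \<open>\<alpha> g * g\<^sup>-\<^sup>1\<close>, lies in both subgroups;
  hence \<open>\<alpha> g = g\<close>.
\<close>
lemma normal_AutoGroup_cases:
  assumes K: "K \<lhd> AutoGroup G"
  shows "Inn G \<subseteq> K \<or> K = {\<one>\<^bsub>AutoGroup G\<^esub>}"
proof -
  interpret K: normal K "AutoGroup G" by fact
  interpret c: group_hom G "AutoGroup G" "inner_aut G" by (rule group_hom_inner_aut)
  consider "{g \<in> carrier G. inner_aut G g \<in> K} = carrier G" | "{g \<in> carrier G. inner_aut G g \<in> K} = {\<one>}"
    using no_real_normal_subgroup[OF c.normal_vimage[OF K]] by blast
  then show ?thesis
  proof cases
    case 1
    then show ?thesis by (auto simp: Inn_def)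
  next
    case 2
    have "\<alpha> = \<one>\<^bsub>AutoGroup G\<^esub>" if \<alpha>K: "\<alpha> \<in> K" for \<alpha>
    proof -
      have \<alpha>: "\<alpha> \<in> carrier (AutoGroup G)" using \<alpha>K K.subset by blast
      have fixed: "\<alpha> g = g" if g: "g \<in> carrier G" for g
      proof -
        have \<alpha>g: "\<alpha> g \<in> carrier G" using autoD(4)[OF \<alpha>] g by blast
        have "\<alpha> \<otimes>\<^bsub>AutoGroup G\<^esub> (inner_aut G g \<otimes>\<^bsub>AutoGroup G\<^esub> inv\<^bsub>AutoGroup G\<^esub> \<alpha> \<otimes>\<^bsub>AutoGroup G\<^esub> inv\<^bsub>AutoGroup G\<^esub> inner_aut G g) \<in> K"
          using \<alpha>K g by (intro subgroup.m_closed[OF K.subgroup_axioms] K.inv_op_closed2)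
              (auto simp: inner_aut_mem subgroup.m_inv_closed[OF K.subgroup_axioms])
        also have "\<alpha> \<otimes>\<^bsub>AutoGroup G\<^esub> (inner_aut G g \<otimes>\<^bsub>AutoGroup G\<^esub> inv\<^bsub>AutoGroup G\<^esub> \<alpha> \<otimes>\<^bsub>AutoGroup G\<^esub> inv\<^bsub>AutoGroup G\<^esub> inner_aut G g)
            = (\<alpha> \<otimes>\<^bsub>AutoGroup G\<^esub> inner_aut G g) \<otimes>\<^bsub>AutoGroup G\<^esub> inv\<^bsub>AutoGroup G\<^esub> \<alpha> \<otimes>\<^bsub>AutoGroup G\<^esub> inv\<^bsub>AutoGroup G\<^esub> inner_aut G g"
          using \<alpha> g by (simp add: K.m_assoc inner_aut_mem)
        also have "\<dots> = inner_aut G (\<alpha> g \<otimes> inv g)"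
          using \<alpha> g \<alpha>g by (simp add: auto_mult_inner_aut K.m_assoc inner_aut_mem)
        finally have "\<alpha> g \<otimes> inv g = \<one>" using 2 g \<alpha>g by blast
        then show ?thesis using g \<alpha>g by (metis inv_equality inv_inv inv_closed)
      qed
      show ?thesis
        using autoD(2)[OF \<alpha>] fixed by (auto simp: one_AutoGroup extensional_def fun_eq_iff)
    qed
    then show ?thesis using subgroup.one_closed[OF K.subgroup_axioms] by blast
  qed
qed

lemma endomorphism_mem_auto:
  assumes "finite (carrier G)" "\<phi> \<in> Homs G G" "x \<in> carrier G" "\<phi> x \<noteq> \<one>"
  shows "\<phi> \<in> carrier (AutoGroup G)"
proof -
  have \<phi>: "\<phi> \<in> hom G G" using assms by (simp add: Homs_def)
  then have "inj_on \<phi> (carrier G)" using inj_on_hom_or_trivial[OF \<phi> is_group] assms by blast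
  moreover have "\<phi> ` carrier G \<subseteq> carrier G" using hom_in_carrier[OF \<phi>] by blast
  ultimately have "bij_betw \<phi> (carrier G) (carrier G)"
    using endo_inj_surj[OF assms(1)] by (simp add: bij_betw_def)
  then show ?thesis using assms by (simp add: carrier_AutoGroup auto_def Bij_def Homs_def)
qed

end


section \<open>Localizations between finite simple groups\<close>

text \<open>
  An injective localization \<open>i : H \<rightarrow> G\<close> between finite non-abelian simple groups.
\<close>
locale simple_group_localization = H: simple_group H + G: simple_group G
  for H :: "('a, 'm) monoid_scheme" and G :: "('b, 'n) monoid_scheme" +
  fixes i :: "'a \<Rightarrow> 'b"
  assumes finite_H: "finite (carrier H)" and finite_G: "finite (carrier G)"
    and H_nonabelian: "\<not> comm_group H" and G_nonabelian: "\<not> comm_group G"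
    and i_mon: "i \<in> mon H G" and i_localization: "localization H G i"
begin

sublocale AutH: group "AutoGroup H" by (rule H.AutoGroup)
sublocale AutG: group "AutoGroup G" by (rule G.AutoGroup)
sublocale i: group_hom H G i
  using i_mon by unfold_locales (simp add: mon_def)
sublocale InnH: normal "Inn H" "AutoGroup H" by (rule H.Inn_normal)
sublocale InnG: normal "Inn G" "AutoGroup G" by (rule G.Inn_normal)

lemma ex_nontrivial: obtains h where "h \<in> carrier H" "h \<noteq> \<one>\<^bsub>H\<^esub>"
  using H.simple_not_triv H.one_closed by blast

lemma extension_unique:
  assumes "\<phi> \<in> Homs G G" "\<psi> \<in> Homs G G" "\<And>h. h \<in> carrier H \<Longrightarrow> \<phi> (i h) = \<psi> (i h)"
  shows "\<phi> = \<psi>"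
proof -
  have "inj_on (\<lambda>f. compose (carrier H) f i) (Homs G G)"
    using i_localization by (simp add: localization_def bij_betw_def)
  moreover have "compose (carrier H) \<phi> i = compose (carrier H) \<psi> i"
    using assms(3) by (simp add: compose_def fun_eq_iff)
  ultimately show ?thesis using assms by (simp add: inj_on_def)
qed

lemma ex_extension:
  assumes k: "k \<in> hom H G"
  obtains \<phi> where "\<phi> \<in> Homs G G" "\<And>h. h \<in> carrier H \<Longrightarrow> \<phi> (i h) = k h"
proof -
  have "restrict k (carrier H) \<in> Homs H G"
    using k by (auto simp: Homs_def hom_def)
  then obtain \<phi> where "\<phi> \<in> Homs G G" "compose (carrier H) \<phi> i = restrict k (carrier H)"
    using i_localization unfolding localization_def bij_betw_def by (metis imageE)
  then show ?thesis using that[of \<phi>] by (metis compose_eq restrict_apply')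
qed

text \<open>
  The extension is nontrivial, and a nontrivial endomorphism of a finite simple group is bijective.
\<close>
lemma ex_automorphism_extension:
  assumes k: "k \<in> hom H G" "inj_on k (carrier H)"
  obtains \<phi> where "\<phi> \<in> carrier (AutoGroup G)" "\<And>h. h \<in> carrier H \<Longrightarrow> \<phi> (i h) = k h"
proof -
  obtain \<phi> where \<phi>: "\<phi> \<in> Homs G G" "\<And>h. h \<in> carrier H \<Longrightarrow> \<phi> (i h) = k h"
    using ex_extension[OF k(1)] by blast
  obtain h where h: "h \<in> carrier H" "h \<noteq> \<one>\<^bsub>H\<^esub>" by (rule ex_nontrivial)
  have "k h \<noteq> \<one>\<^bsub>G\<^esub>"
    using h k H.one_closed hom_one[OF k(1) H.is_group G.is_group] by (metis inj_on_def)
  then have "\<phi> \<in> carrier (AutoGroup G)"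
    using \<phi> h by (intro G.endomorphism_mem_auto[of _ "i h"]) (auto simp: finite_G)
  then show ?thesis using \<phi>(2) that by blast
qed

lemma AutoGroup_subset_Homs: "carrier (AutoGroup G) \<subseteq> Homs G G"
  using autoD by (auto simp: Homs_def)

text \<open>
  An automorphism that commutes with conjugation by \<open>x\<close> fixes \<open>x\<close>.  So \<open>\<beta>\<close> fixes \<open>\<phi> (i h)\<close> for all
  \<open>h\<close>; both \<open>\<beta> \<circ> \<phi>\<close> and \<open>\<phi>\<close> extend \<open>\<phi> \<circ> i\<close> along \<open>i\<close>, and are equal.
\<close>
lemma centralizer_trivial:
  assumes \<phi>: "\<phi> \<in> carrier (AutoGroup G)" and \<beta>: "\<beta> \<in> carrier (AutoGroup G)"
    and comm: "\<And>h. h \<in> carrier H \<Longrightarrow>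
      \<beta> \<otimes>\<^bsub>AutoGroup G\<^esub> inner_aut G (\<phi> (i h)) = inner_aut G (\<phi> (i h)) \<otimes>\<^bsub>AutoGroup G\<^esub> \<beta>"
  shows "\<beta> = \<one>\<^bsub>AutoGroup G\<^esub>"
proof -
  have fixed: "\<beta> (\<phi> (i h)) = \<phi> (i h)" if h: "h \<in> carrier H" for h
  proof -
    have x: "\<phi> (i h) \<in> carrier G" using i.hom_closed[OF h] autoD(4)[OF \<phi>] by blast
    have \<beta>x: "\<beta> (\<phi> (i h)) \<in> carrier G" using x autoD(4)[OF \<beta>] by blast
    have "inner_aut G (\<beta> (\<phi> (i h))) \<otimes>\<^bsub>AutoGroup G\<^esub> \<beta> = inner_aut G (\<phi> (i h)) \<otimes>\<^bsub>AutoGroup G\<^esub> \<beta>"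
      using comm[OF h] G.auto_mult_inner_aut[OF \<beta> x] by simp
    then have "inner_aut G (\<beta> (\<phi> (i h))) = inner_aut G (\<phi> (i h))"
      using \<beta> x \<beta>x by (simp add: G.inner_aut_mem)
    then show ?thesis using G.inner_aut_inj[OF G_nonabelian] x \<beta>x by (simp add: inj_on_def)
  qed
  have "\<beta> \<otimes>\<^bsub>AutoGroup G\<^esub> \<phi> = \<phi>"
  proof (rule extension_unique)
    show "\<beta> \<otimes>\<^bsub>AutoGroup G\<^esub> \<phi> \<in> Homs G G" "\<phi> \<in> Homs G G"
      using AutoGroup_subset_Homs AutG.m_closed[OF \<beta> \<phi>] \<phi> by auto
    show "(\<beta> \<otimes>\<^bsub>AutoGroup G\<^esub> \<phi>) (i h) = \<phi> (i h)" if "h \<in> carrier H" for h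
      using fixed[OF that] that by (simp add: mult_AutoGroup[OF \<beta> \<phi>] compose_def)
  qed
  then show ?thesis using \<beta> \<phi> by (metis AutG.r_cancel_one)
qed

text \<open>
  For an automorphism \<open>\<alpha>\<close> of \<open>H\<close>, the automorphism \<open>j \<alpha>\<close> of \<open>G\<close> is the unique one restricting to \<open>\<alpha>\<close>
  along \<open>i\<close>.
\<close>
lemma ex_AutoGroup_extension:
  "\<exists>j \<in> mon (AutoGroup H) (AutoGroup G). extends_to_Aut H G i j"
proof -
  have "\<exists>\<beta>. \<beta> \<in> carrier (AutoGroup G) \<and> (\<forall>h \<in> carrier H. \<beta> (i h) = i (\<alpha> h))"
    if \<alpha>: "\<alpha> \<in> carrier (AutoGroup H)" for \<alpha>
  proof -
    have "i \<circ> \<alpha> \<in> hom H G" using autoD(1)[OF \<alpha>] i.homh by (rule hom_compose)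
    moreover have "inj_on (i \<circ> \<alpha>) (carrier H)"
      using autoD(3,4)[OF \<alpha>] i_mon by (simp add: comp_inj_on mon_def)
    ultimately obtain \<beta> where "\<beta> \<in> carrier (AutoGroup G)" "\<And>h. h \<in> carrier H \<Longrightarrow> \<beta> (i h) = (i \<circ> \<alpha>) h"
      using ex_automorphism_extension by blast
    then show ?thesis by auto
  qed
  then obtain j where j: "\<And>\<alpha>. \<alpha> \<in> carrier (AutoGroup H) \<Longrightarrow> j \<alpha> \<in> carrier (AutoGroup G)"
    and j_i: "\<And>\<alpha> h. \<alpha> \<in> carrier (AutoGroup H) \<Longrightarrow> h \<in> carrier H \<Longrightarrow> j \<alpha> (i h) = i (\<alpha> h)"
    by metis
  have AutH_closed: "\<alpha> h \<in> carrier H" if "\<alpha> \<in> carrier (AutoGroup H)" "h \<in> carrier H" for \<alpha> h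
    using autoD(4)[OF that(1)] that(2) by blast
  have j_eqI: "j \<alpha> = \<beta>"
    if "\<alpha> \<in> carrier (AutoGroup H)" "\<beta> \<in> carrier (AutoGroup G)"
      "\<And>h. h \<in> carrier H \<Longrightarrow> \<beta> (i h) = i (\<alpha> h)" for \<alpha> \<beta>
    using that j j_i AutoGroup_subset_Homs by (intro extension_unique) auto
  have "j \<in> hom (AutoGroup H) (AutoGroup G)"
  proof (rule homI)
    fix \<alpha> \<alpha>' assume \<alpha>: "\<alpha> \<in> carrier (AutoGroup H)" and \<alpha>': "\<alpha>' \<in> carrier (AutoGroup H)"
    show "j (\<alpha> \<otimes>\<^bsub>AutoGroup H\<^esub> \<alpha>') = j \<alpha> \<otimes>\<^bsub>AutoGroup G\<^esub> j \<alpha>'"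
      using \<alpha> \<alpha>'
      by (intro j_eqI AutH.m_closed AutG.m_closed j) (auto simp: j mult_AutoGroup compose_def j_i AutH_closed)
  qed (rule j)
  moreover have "inj_on j (carrier (AutoGroup H))"
  proof (rule inj_onI)
    fix \<alpha> \<alpha>' assume \<alpha>: "\<alpha> \<in> carrier (AutoGroup H)" and \<alpha>': "\<alpha>' \<in> carrier (AutoGroup H)" and eq: "j \<alpha> = j \<alpha>'"
    have "\<alpha> h = \<alpha>' h" if h: "h \<in> carrier H" for h
    proof -
      have "i (\<alpha> h) = i (\<alpha>' h)" using j_i[OF \<alpha> h] j_i[OF \<alpha>' h] eq by simp
      then show ?thesis
        using i_mon AutH_closed[OF \<alpha> h] AutH_closed[OF \<alpha>' h] by (simp add: mon_def inj_on_def)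
    qed
    then show "\<alpha> = \<alpha>'" using autoD(2)[OF \<alpha>] autoD(2)[OF \<alpha>'] by (rule extensionalityI[rotated 2])
  qed
  moreover have "extends_to_Aut H G i j"
    unfolding extends_to_Aut_def
    by (intro ballI j_eqI G.inner_aut_mem H.inner_aut_mem) (auto simp: inner_aut_def)
  ultimately show ?thesis by (auto simp: mon_def)
qed

end

section \<open>Extensions inducing an isomorphism of outer automorphism groups\<close>

text \<open>
  A homomorphism \<open>j : Aut H \<rightarrow> Aut G\<close> that extends \<open>i\<close> and induces an isomorphism \<open>Out H \<cong> Out G\<close>.
  Such a \<open>j\<close> is injective by \<open>normal_AutoGroup_cases\<close>, because its kernel does not contain \<open>Inn H\<close>.
\<close>
locale Out_iso_extension = simple_group_localization H G i
  for H :: "('a, 'm) monoid_scheme" and G :: "('b, 'n) monoid_scheme" and i :: "'a \<Rightarrow> 'b" +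
  fixes j :: "('a \<Rightarrow> 'a) \<Rightarrow> ('b \<Rightarrow> 'b)"
  assumes j_hom: "j \<in> hom (AutoGroup H) (AutoGroup G)"
    and j_extends: "extends_to_Aut H G i j"
    and Out_iso: "Out_map G j \<in> iso (Out H) (Out G)"
begin

sublocale j: group_hom "AutoGroup H" "AutoGroup G" j
  using j_hom by unfold_locales

lemma j_inner_aut: "h \<in> carrier H \<Longrightarrow> j (inner_aut H h) = inner_aut G (i h)"
  using j_extends by (simp add: extends_to_Aut_def)

lemma Out_map_rcoset:
  "\<alpha> \<in> carrier (AutoGroup H) \<Longrightarrow>
    Out_map G j (Inn H #>\<^bsub>AutoGroup H\<^esub> \<alpha>) = Inn G #>\<^bsub>AutoGroup G\<^esub> j \<alpha>"
  by (rule Out_map_coset[OF H.is_group G.is_group i.homh j_hom j_extends])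

lemma Out_map_bij:
  "bij_betw (Out_map G j) (rcosets\<^bsub>AutoGroup H\<^esub> Inn H) (rcosets\<^bsub>AutoGroup G\<^esub> Inn G)"
  using Out_iso by (simp add: iso_def Out_def FactGroup_def)

lemma ex_rcoset_j:
  assumes "\<beta> \<in> carrier (AutoGroup G)"
  shows "\<exists>\<alpha> \<in> carrier (AutoGroup H). Inn G #>\<^bsub>AutoGroup G\<^esub> j \<alpha> = Inn G #>\<^bsub>AutoGroup G\<^esub> \<beta>"
proof -
  have "Inn G #>\<^bsub>AutoGroup G\<^esub> \<beta> \<in> Out_map G j ` (rcosets\<^bsub>AutoGroup H\<^esub> Inn H)"
    using Out_map_bij AutG.rcosetsI[OF InnG.subset assms] by (simp add: bij_betw_def)
  then show ?thesis using Out_map_rcoset by (auto simp: RCOSETS_def)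
qed

lemma rcoset_j_inject:
  assumes "\<alpha> \<in> carrier (AutoGroup H)" "\<alpha>' \<in> carrier (AutoGroup H)"
    and "Inn G #>\<^bsub>AutoGroup G\<^esub> j \<alpha> = Inn G #>\<^bsub>AutoGroup G\<^esub> j \<alpha>'"
  shows "Inn H #>\<^bsub>AutoGroup H\<^esub> \<alpha> = Inn H #>\<^bsub>AutoGroup H\<^esub> \<alpha>'"
proof (rule inj_onD[OF bij_betw_imp_inj_on[OF Out_map_bij]])
  show "Out_map G j (Inn H #>\<^bsub>AutoGroup H\<^esub> \<alpha>) = Out_map G j (Inn H #>\<^bsub>AutoGroup H\<^esub> \<alpha>')"
    using assms by (simp only: Out_map_rcoset)
qed (use assms in \<open>auto intro: AutH.rcosetsI[OF InnH.subset]\<close>)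

lemma card_rcosets_Inn:
  "card (rcosets\<^bsub>AutoGroup G\<^esub> Inn G) < card (carrier (AutoGroup H))"
proof -
  have lagrange: "card (rcosets\<^bsub>AutoGroup H\<^esub> Inn H) * card (Inn H) = card (carrier (AutoGroup H))"
    using AutH.lagrange[OF InnH.subgroup_axioms] by (simp only: order_def)
  have "1 < card (Inn H)"
    using H.order_gt_one H.inner_aut_inj[OF H_nonabelian] by (simp add: Inn_def card_image order_def)
  moreover have "0 < card (rcosets\<^bsub>AutoGroup H\<^esub> Inn H)"
  proof (rule Nat.gr0I)
    assume "card (rcosets\<^bsub>AutoGroup H\<^esub> Inn H) = 0"
    then have "card (carrier (AutoGroup H)) = 0" using lagrange by (simp only: mult_0)
    then show False using finite_auto[OF finite_H] AutH.one_closed card_0_eq by blast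
  qed
  ultimately have "card (rcosets\<^bsub>AutoGroup H\<^esub> Inn H) < card (carrier (AutoGroup H))"
    using mult_strict_left_mono[of 1 "card (Inn H)" "card (rcosets\<^bsub>AutoGroup H\<^esub> Inn H)"]
    by (simp only: lagrange mult_1_right)
  then show ?thesis by (simp only: bij_betw_same_card[OF Out_map_bij])
qed

text \<open>
  The extension sends \<open>\<beta>\<close> to \<open>f (r \<beta>)\<close>, where \<open>j (r \<beta>)\<close> lies in the coset of \<open>\<beta>\<close> modulo \<open>Inn G\<close>.  The value
  does not depend on the choice of \<open>r \<beta>\<close>, because that is unique modulo \<open>Inn H\<close>.
\<close>
lemma hom_extends_if_trivial_on_Inn:
  assumes f: "f \<in> hom (AutoGroup H) (AutoGroup G)"
    and trivial: "\<And>h. h \<in> carrier H \<Longrightarrow> f (inner_aut H h) = \<one>\<^bsub>AutoGroup G\<^esub>"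
  shows "\<exists>g \<in> hom (AutoGroup G) (AutoGroup G). \<forall>\<alpha> \<in> carrier (AutoGroup H). g (j \<alpha>) = f \<alpha>"
proof -
  interpret f: group_hom "AutoGroup H" "AutoGroup G" f using f by unfold_locales
  have f_eq: "f \<alpha> = f \<alpha>'"
    if \<alpha>: "\<alpha> \<in> carrier (AutoGroup H)" "\<alpha>' \<in> carrier (AutoGroup H)"
      and eq: "Inn G #>\<^bsub>AutoGroup G\<^esub> j \<alpha> = Inn G #>\<^bsub>AutoGroup G\<^esub> j \<alpha>'" for \<alpha> \<alpha>'
  proof -
    have "\<alpha> \<in> Inn H #>\<^bsub>AutoGroup H\<^esub> \<alpha>'"
      using AutH.rcos_self[OF \<alpha>(1) InnH.subgroup_axioms] rcoset_j_inject[OF \<alpha> eq] by simp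
    then obtain h where "h \<in> carrier H" "\<alpha> = inner_aut H h \<otimes>\<^bsub>AutoGroup H\<^esub> \<alpha>'"
      by (auto simp: r_coset_def Inn_def)
    then show ?thesis using trivial \<alpha> by (simp add: H.inner_aut_mem)
  qed
  obtain r where r: "\<And>\<beta>. \<beta> \<in> carrier (AutoGroup G) \<Longrightarrow> r \<beta> \<in> carrier (AutoGroup H)"
    and r_coset: "\<And>\<beta>. \<beta> \<in> carrier (AutoGroup G) \<Longrightarrow>
      Inn G #>\<^bsub>AutoGroup G\<^esub> j (r \<beta>) = Inn G #>\<^bsub>AutoGroup G\<^esub> \<beta>"
    using ex_rcoset_j by metis
  have "f \<circ> r \<in> hom (AutoGroup G) (AutoGroup G)"
  proof (rule homI)
    fix \<beta> \<gamma> assume \<beta>: "\<beta> \<in> carrier (AutoGroup G)" and \<gamma>: "\<gamma> \<in> carrier (AutoGroup G)"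
    have "Inn G #>\<^bsub>AutoGroup G\<^esub> j (r (\<beta> \<otimes>\<^bsub>AutoGroup G\<^esub> \<gamma>)) = Inn G #>\<^bsub>AutoGroup G\<^esub> (\<beta> \<otimes>\<^bsub>AutoGroup G\<^esub> \<gamma>)"
      using \<beta> \<gamma> by (intro r_coset) simp
    also have "\<dots> = (Inn G #>\<^bsub>AutoGroup G\<^esub> j (r \<beta>)) <#>\<^bsub>AutoGroup G\<^esub> (Inn G #>\<^bsub>AutoGroup G\<^esub> j (r \<gamma>))"
      using \<beta> \<gamma> by (simp add: r_coset InnG.rcos_sum)
    also have "\<dots> = Inn G #>\<^bsub>AutoGroup G\<^esub> j (r \<beta> \<otimes>\<^bsub>AutoGroup H\<^esub> r \<gamma>)"
      using \<beta> \<gamma> r by (simp add: InnG.rcos_sum)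
    finally have "f (r (\<beta> \<otimes>\<^bsub>AutoGroup G\<^esub> \<gamma>)) = f (r \<beta> \<otimes>\<^bsub>AutoGroup H\<^esub> r \<gamma>)"
      using \<beta> \<gamma> r by (intro f_eq) auto
    then show "(f \<circ> r) (\<beta> \<otimes>\<^bsub>AutoGroup G\<^esub> \<gamma>) = (f \<circ> r) \<beta> \<otimes>\<^bsub>AutoGroup G\<^esub> (f \<circ> r) \<gamma>"
      using \<beta> \<gamma> r by simp
  qed (use r in auto)
  moreover have "(f \<circ> r) (j \<alpha>) = f \<alpha>" if "\<alpha> \<in> carrier (AutoGroup H)" for \<alpha>
    using that r r_coset by (auto intro: f_eq)
  ultimately show ?thesis by blast
qed

lemma hom_trivial_or_inj:
  assumes f: "f \<in> hom (AutoGroup H) (AutoGroup G)"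
  shows "(\<forall>h \<in> carrier H. f (inner_aut H h) = \<one>\<^bsub>AutoGroup G\<^esub>) \<or> inj_on f (carrier (AutoGroup H))"
proof -
  interpret f: group_hom "AutoGroup H" "AutoGroup G" f using f by unfold_locales
  show ?thesis
    using H.normal_AutoGroup_cases[OF f.normal_kernel] f.inj_iff_trivial_ker
    by (auto simp: kernel_def Inn_def)
qed

text \<open>
  The preimage of \<open>Inn G\<close> is normal, so if it did not contain \<open>Inn H\<close> it would be trivial; then
  \<open>Aut H\<close> would embed into \<open>Out G\<close>, which has the order of \<open>Out H\<close> and is too small.
\<close>
lemma inj_hom_maps_Inn:
  assumes f: "f \<in> hom (AutoGroup H) (AutoGroup G)" and inj: "inj_on f (carrier (AutoGroup H))"
    and h: "h \<in> carrier H"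
  shows "f (inner_aut H h) \<in> Inn G"
proof (rule ccontr)
  assume not: "f (inner_aut H h) \<notin> Inn G"
  interpret f: group_hom "AutoGroup H" "AutoGroup G" f using f by unfold_locales
  have K: "{\<alpha> \<in> carrier (AutoGroup H). f \<alpha> \<in> Inn G} = {\<one>\<^bsub>AutoGroup H\<^esub>}"
    using H.normal_AutoGroup_cases[OF f.normal_vimage[OF G.Inn_normal]] not h by (auto simp: Inn_def[of H])
  have "inj_on (\<lambda>\<alpha>. Inn G #>\<^bsub>AutoGroup G\<^esub> f \<alpha>) (carrier (AutoGroup H))"
  proof (rule inj_onI)
    fix \<alpha> \<beta> assume \<alpha>: "\<alpha> \<in> carrier (AutoGroup H)" and \<beta>: "\<beta> \<in> carrier (AutoGroup H)"
      and eq: "Inn G #>\<^bsub>AutoGroup G\<^esub> f \<alpha> = Inn G #>\<^bsub>AutoGroup G\<^esub> f \<beta>"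
    have "f \<alpha> \<in> Inn G #>\<^bsub>AutoGroup G\<^esub> f \<beta>"
      using AutG.rcos_self[OF _ InnG.subgroup_axioms, of "f \<alpha>"] \<alpha> eq by simp
    then have "f \<alpha> \<otimes>\<^bsub>AutoGroup G\<^esub> inv\<^bsub>AutoGroup G\<^esub> f \<beta> \<in> Inn G"
      using InnG.rcos_module_imp[OF AutG.is_group] \<beta> by simp
    then have "\<alpha> \<otimes>\<^bsub>AutoGroup H\<^esub> inv\<^bsub>AutoGroup H\<^esub> \<beta> \<in> {\<alpha> \<in> carrier (AutoGroup H). f \<alpha> \<in> Inn G}"
      using \<alpha> \<beta> by simp
    then have "\<alpha> \<otimes>\<^bsub>AutoGroup H\<^esub> inv\<^bsub>AutoGroup H\<^esub> \<beta> = \<one>\<^bsub>AutoGroup H\<^esub>"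
      unfolding K by blast
    then show "\<alpha> = \<beta>" using \<alpha> \<beta> by (metis AutH.inv_closed AutH.inv_equality AutH.inv_inv)
  qed
  moreover have "(\<lambda>\<alpha>. Inn G #>\<^bsub>AutoGroup G\<^esub> f \<alpha>) ` carrier (AutoGroup H) \<subseteq> rcosets\<^bsub>AutoGroup G\<^esub> Inn G"
    using AutG.rcosetsI[OF InnG.subset] by auto
  moreover have "finite (rcosets\<^bsub>AutoGroup G\<^esub> Inn G)"
    using finite_auto[OF finite_G] by (simp add: RCOSETS_def)
  ultimately have "card (carrier (AutoGroup H)) \<le> card (rcosets\<^bsub>AutoGroup G\<^esub> Inn G)"
    by (rule card_inj_on_le)
  then show False using card_rcosets_Inn by simp
qed

text \<open>
  As \<open>Inn G\<close> is isomorphic to \<open>G\<close>, the restriction of \<open>f\<close> to \<open>Inn H\<close> amounts to an injective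
  homomorphism \<open>k : H \<rightarrow> G\<close>, which factors through \<open>i\<close>.
\<close>
lemma inj_hom_on_Inn:
  assumes f: "f \<in> hom (AutoGroup H) (AutoGroup G)" and inj: "inj_on f (carrier (AutoGroup H))"
  obtains \<phi> where "\<phi> \<in> carrier (AutoGroup G)"
    "\<And>h. h \<in> carrier H \<Longrightarrow> f (inner_aut H h) = inner_aut G (\<phi> (i h))"
proof -
  interpret f: group_hom "AutoGroup H" "AutoGroup G" f using f by unfold_locales
  interpret cH: group_hom H "AutoGroup H" "inner_aut H" by (rule H.group_hom_inner_aut)
  interpret cG: group_hom G "AutoGroup G" "inner_aut G" by (rule G.group_hom_inner_aut)
  have "\<exists>x. x \<in> carrier G \<and> f (inner_aut H h) = inner_aut G x" if "h \<in> carrier H" for h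
    using inj_hom_maps_Inn[OF f inj that] by (auto simp: Inn_def)
  then obtain k where k: "\<And>h. h \<in> carrier H \<Longrightarrow> k h \<in> carrier G"
    and fk: "\<And>h. h \<in> carrier H \<Longrightarrow> f (inner_aut H h) = inner_aut G (k h)"
    by metis
  have "k \<in> hom H G"
  proof (rule homI)
    fix x y assume xy: "x \<in> carrier H" "y \<in> carrier H"
    have "inner_aut G (k (x \<otimes>\<^bsub>H\<^esub> y)) = f (inner_aut H x \<otimes>\<^bsub>AutoGroup H\<^esub> inner_aut H y)"
      using xy by (simp flip: fk)
    also have "\<dots> = inner_aut G (k x \<otimes>\<^bsub>G\<^esub> k y)"
      using xy k by (simp add: fk)
    finally show "k (x \<otimes>\<^bsub>H\<^esub> y) = k x \<otimes>\<^bsub>G\<^esub> k y"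
      using G.inner_aut_inj[OF G_nonabelian] k xy by (simp add: inj_on_def)
  qed (rule k)
  moreover have "inj_on k (carrier H)"
  proof (rule inj_onI)
    fix x y assume xy: "x \<in> carrier H" "y \<in> carrier H" "k x = k y"
    then have "inner_aut H x = inner_aut H y"
      using fk inj cH.hom_closed by (metis inj_on_def)
    then show "x = y" using H.inner_aut_inj[OF H_nonabelian] xy by (simp add: inj_on_def)
  qed
  ultimately obtain \<phi> where "\<phi> \<in> carrier (AutoGroup G)" "\<And>h. h \<in> carrier H \<Longrightarrow> \<phi> (i h) = k h"
    using ex_automorphism_extension by blast
  then show ?thesis using fk that by auto
qed

text \<open>
  Conjugation by \<open>\<phi>\<close> in \<open>Aut G\<close> maps conjugation by \<open>x\<close> to conjugation by \<open>\<phi> x\<close>, so composed with \<open>j\<close> it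
  agrees with \<open>f\<close> on \<open>Inn H\<close>.
\<close>
lemma hom_extends_if_inj:
  assumes f: "f \<in> hom (AutoGroup H) (AutoGroup G)" and inj: "inj_on f (carrier (AutoGroup H))"
  shows "\<exists>g \<in> hom (AutoGroup G) (AutoGroup G). \<forall>\<alpha> \<in> carrier (AutoGroup H). g (j \<alpha>) = f \<alpha>"
proof -
  obtain \<phi> where \<phi>: "\<phi> \<in> carrier (AutoGroup G)"
    and f_inn: "\<And>h. h \<in> carrier H \<Longrightarrow> f (inner_aut H h) = inner_aut G (\<phi> (i h))"
    using inj_hom_on_Inn[OF f inj] by blast
  define g where "g = inner_aut (AutoGroup G) \<phi>"
  have g: "g \<in> hom (AutoGroup G) (AutoGroup G)"
    unfolding g_def by (rule autoD(1)[OF AutG.inner_aut_mem[OF \<phi>]])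
  have g_eq: "g (inner_aut G x) = inner_aut G (\<phi> x)" if x: "x \<in> carrier G" for x
  proof -
    have "\<phi> x \<in> carrier G" using autoD(4)[OF \<phi>] x by blast
    then show ?thesis
      using x \<phi> unfolding g_def inner_aut_def[of "AutoGroup G"]
      by (simp add: G.inner_aut_mem G.auto_mult_inner_aut AutG.m_assoc)
  qed
  have "(g \<circ> j) \<alpha> = f \<alpha>" if "\<alpha> \<in> carrier (AutoGroup H)" for \<alpha>
  proof (rule homs_agreeing_on_normal_eq[OF hom_compose[OF j_hom g] f H.Inn_normal AutG.is_group _ _ that])
    show eq: "(g \<circ> j) m = f m" if "m \<in> Inn H" for m
      using that by (auto simp: Inn_def j_inner_aut g_eq f_inn)
    show "b = \<one>\<^bsub>AutoGroup G\<^esub>"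
      if b: "b \<in> carrier (AutoGroup G)"
        and comm: "\<And>m. m \<in> Inn H \<Longrightarrow> b \<otimes>\<^bsub>AutoGroup G\<^esub> (g \<circ> j) m = (g \<circ> j) m \<otimes>\<^bsub>AutoGroup G\<^esub> b" for b
    proof (rule centralizer_trivial[OF \<phi> b])
      fix h assume h: "h \<in> carrier H"
      then show "b \<otimes>\<^bsub>AutoGroup G\<^esub> inner_aut G (\<phi> (i h)) = inner_aut G (\<phi> (i h)) \<otimes>\<^bsub>AutoGroup G\<^esub> b"
        using comm[of "inner_aut H h"] by (simp add: Inn_def j_inner_aut g_eq)
    qed
  qed
  then show ?thesis using g by auto
qed

text \<open>
  An endomorphism of \<open>Aut G\<close> is not assumed to preserve \<open>Inn G\<close>.  The preimage of \<open>Inn G\<close> is normal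
  and contains the nontrivial group \<open>j (Inn H)\<close>, hence contains \<open>Inn G\<close>.  The endomorphism of \<open>G\<close>
  induced in this way agrees with \<open>\<phi>\<close> on \<open>i H\<close>, hence everywhere.
\<close>
lemma hom_maps_Inn_via:
  assumes g: "g \<in> hom (AutoGroup G) (AutoGroup G)" and \<phi>: "\<phi> \<in> carrier (AutoGroup G)"
    and g_inn: "\<And>h. h \<in> carrier H \<Longrightarrow> g (inner_aut G (i h)) = inner_aut G (\<phi> (i h))"
    and x: "x \<in> carrier G"
  shows "g (inner_aut G x) = inner_aut G (\<phi> x)"
proof -
  interpret g: group_hom "AutoGroup G" "AutoGroup G" g using g by unfold_locales
  interpret cG: group_hom G "AutoGroup G" "inner_aut G" by (rule G.group_hom_inner_aut)
  note inner_eq = inj_onD[OF G.inner_aut_inj[OF G_nonabelian]]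
  have \<phi>_closed: "\<phi> x \<in> carrier G" if "x \<in> carrier G" for x using autoD(4)[OF \<phi>] that by blast
  obtain h where h: "h \<in> carrier H" "h \<noteq> \<one>\<^bsub>H\<^esub>" by (rule ex_nontrivial)
  have "i h \<noteq> \<one>\<^bsub>G\<^esub>" using h i_mon by (metis (no_types, lifting) H.one_closed i.hom_one inj_onD mem_Collect_eq mon_def)
  then have "inner_aut G (i h) \<noteq> \<one>\<^bsub>AutoGroup G\<^esub>"
    using inner_eq[of "i h" "\<one>\<^bsub>G\<^esub>"] h cG.hom_one by auto
  moreover have "inner_aut G (i h) \<in> {\<beta> \<in> carrier (AutoGroup G). g \<beta> \<in> Inn G}"
    using h \<phi>_closed by (auto simp: g_inn Inn_def)
  ultimately have "Inn G \<subseteq> {\<beta> \<in> carrier (AutoGroup G). g \<beta> \<in> Inn G}"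
    using G.normal_AutoGroup_cases[OF g.normal_vimage[OF G.Inn_normal]] by blast
  then have "\<exists>y. y \<in> carrier G \<and> g (inner_aut G x) = inner_aut G y" if "x \<in> carrier G" for x
    using that by (auto simp: Inn_def)
  then obtain \<psi> where \<psi>: "\<And>x. x \<in> carrier G \<Longrightarrow> \<psi> x \<in> carrier G"
    and g\<psi>: "\<And>x. x \<in> carrier G \<Longrightarrow> g (inner_aut G x) = inner_aut G (\<psi> x)"
    by metis
  have "\<psi> \<in> hom G G"
  proof (rule homI)
    fix x y assume xy: "x \<in> carrier G" "y \<in> carrier G"
    have "inner_aut G (\<psi> (x \<otimes>\<^bsub>G\<^esub> y)) = g (inner_aut G x \<otimes>\<^bsub>AutoGroup G\<^esub> inner_aut G y)"
      using xy by (simp flip: g\<psi>)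
    also have "\<dots> = inner_aut G (\<psi> x \<otimes>\<^bsub>G\<^esub> \<psi> y)"
      using xy \<psi> by (simp add: g\<psi>)
    finally show "\<psi> (x \<otimes>\<^bsub>G\<^esub> y) = \<psi> x \<otimes>\<^bsub>G\<^esub> \<psi> y"
      using inner_eq \<psi> xy by simp
  qed (rule \<psi>)
  then have "restrict \<psi> (carrier G) \<in> Homs G G"
    by (auto simp: Homs_def hom_def)
  moreover have "\<psi> (i h) = \<phi> (i h)" if "h \<in> carrier H" for h
    using g\<psi>[of "i h"] g_inn[OF that] that by (intro inner_eq) (auto simp: \<psi> \<phi>_closed)
  ultimately have "restrict \<psi> (carrier G) = \<phi>"
    using \<phi> AutoGroup_subset_Homs by (intro extension_unique) auto
  then show ?thesis using g\<psi>[OF x] x by (metis restrict_apply')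
qed

lemma extension_along_j_unique:
  assumes g: "g \<in> hom (AutoGroup G) (AutoGroup G)" and g': "g' \<in> hom (AutoGroup G) (AutoGroup G)"
    and eq: "\<And>\<alpha>. \<alpha> \<in> carrier (AutoGroup H) \<Longrightarrow> g (j \<alpha>) = g' (j \<alpha>)"
    and \<beta>: "\<beta> \<in> carrier (AutoGroup G)"
  shows "g \<beta> = g' \<beta>"
proof -
  have f: "g \<circ> j \<in> hom (AutoGroup H) (AutoGroup G)" using j_hom g by (rule hom_compose)
  have g_g'_inn: "g (inner_aut G (i h)) = g' (inner_aut G (i h))" if "h \<in> carrier H" for h
    using eq[of "inner_aut H h"] that by (simp add: H.inner_aut_mem j_inner_aut)
  from hom_trivial_or_inj[OF f] show ?thesis
  proof
    assume trivial: "\<forall>h \<in> carrier H. (g \<circ> j) (inner_aut H h) = \<one>\<^bsub>AutoGroup G\<^esub>"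
    \<comment> \<open>The kernel is a nontrivial normal subgroup of \<open>Aut G\<close>.\<close>
    have kills: "e n = \<one>\<^bsub>AutoGroup G\<^esub>"
      if e: "e \<in> hom (AutoGroup G) (AutoGroup G)"
        and e_inn: "\<And>h. h \<in> carrier H \<Longrightarrow> e (inner_aut G (i h)) = \<one>\<^bsub>AutoGroup G\<^esub>"
        and n: "n \<in> Inn G" for e n
    proof -
      interpret e: group_hom "AutoGroup G" "AutoGroup G" e using e by unfold_locales
      interpret cG: group_hom G "AutoGroup G" "inner_aut G" by (rule G.group_hom_inner_aut)
      obtain h where h: "h \<in> carrier H" "h \<noteq> \<one>\<^bsub>H\<^esub>" by (rule ex_nontrivial)
      have "inner_aut G (i h) \<noteq> inner_aut G (i \<one>\<^bsub>H\<^esub>)"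
        using h i_mon G.inner_aut_inj[OF G_nonabelian]
        by (metis (no_types, lifting) H.one_closed i.hom_closed inj_onD mem_Collect_eq mon_def)
      then have "kernel (AutoGroup G) (AutoGroup G) e \<noteq> {\<one>\<^bsub>AutoGroup G\<^esub>}"
        using h e_inn by (auto simp: kernel_def)
      then show ?thesis
        using G.normal_AutoGroup_cases[OF e.normal_kernel] n by (auto simp: kernel_def)
    qed
    interpret g: group_hom "AutoGroup G" "AutoGroup G" g using g by unfold_locales
    interpret g': group_hom "AutoGroup G" "AutoGroup G" g' using g' by unfold_locales
    obtain \<alpha> where \<alpha>: "\<alpha> \<in> carrier (AutoGroup H)" "Inn G #>\<^bsub>AutoGroup G\<^esub> j \<alpha> = Inn G #>\<^bsub>AutoGroup G\<^esub> \<beta>"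
      using ex_rcoset_j[OF \<beta>] by blast
    then obtain n where n: "n \<in> Inn G" "\<beta> = n \<otimes>\<^bsub>AutoGroup G\<^esub> j \<alpha>"
      using AutG.rcos_self[OF \<beta> InnG.subgroup_axioms] by (auto simp: r_coset_def)
    have "n \<in> carrier (AutoGroup G)" using n InnG.subset by blast
    moreover have "g n = \<one>\<^bsub>AutoGroup G\<^esub>" "g' n = \<one>\<^bsub>AutoGroup G\<^esub>"
      using kills[OF g _ n(1)] kills[OF g' _ n(1)] trivial g_g'_inn by (auto simp: j_inner_aut)
    ultimately show ?thesis using n(2) \<alpha>(1) eq by simp
  next
    assume "inj_on (g \<circ> j) (carrier (AutoGroup H))"
    then obtain \<phi> where \<phi>: "\<phi> \<in> carrier (AutoGroup G)"
      and gj: "\<And>h. h \<in> carrier H \<Longrightarrow> (g \<circ> j) (inner_aut H h) = inner_aut G (\<phi> (i h))"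
      using inj_hom_on_Inn[OF f] by blast
    have g_i: "g (inner_aut G (i h)) = inner_aut G (\<phi> (i h))" if "h \<in> carrier H" for h
      using gj[OF that] that by (simp add: j_inner_aut)
    have g'_i: "g' (inner_aut G (i h)) = inner_aut G (\<phi> (i h))" if "h \<in> carrier H" for h
      using g_i[OF that] g_g'_inn[OF that] by simp
    note on_Inn = hom_maps_Inn_via[OF g \<phi> g_i] hom_maps_Inn_via[OF g' \<phi> g'_i]
    show ?thesis
    proof (rule homs_agreeing_on_normal_eq[OF g g' G.Inn_normal AutG.is_group _ _ \<beta>])
      show "g m = g' m" if "m \<in> Inn G" for m using that by (auto simp: Inn_def on_Inn)
      show "b = \<one>\<^bsub>AutoGroup G\<^esub>"
        if b: "b \<in> carrier (AutoGroup G)"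
          and comm: "\<And>m. m \<in> Inn G \<Longrightarrow> b \<otimes>\<^bsub>AutoGroup G\<^esub> g m = g m \<otimes>\<^bsub>AutoGroup G\<^esub> b" for b
      proof (rule centralizer_trivial[OF \<phi> b])
        fix h assume h: "h \<in> carrier H"
        then show "b \<otimes>\<^bsub>AutoGroup G\<^esub> inner_aut G (\<phi> (i h)) = inner_aut G (\<phi> (i h)) \<otimes>\<^bsub>AutoGroup G\<^esub> b"
          using comm[of "inner_aut G (i h)"] g_i[OF h] by (simp add: Inn_def)
      qed
    qed
  qed
qed

lemma localization_j: "localization (AutoGroup H) (AutoGroup G) j"
  unfolding localization_def
proof (intro conjI j_hom bij_betwI')
  fix g g' assume g: "g \<in> Homs (AutoGroup G) (AutoGroup G)" and g': "g' \<in> Homs (AutoGroup G) (AutoGroup G)"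
  show "compose (carrier (AutoGroup H)) g j = compose (carrier (AutoGroup H)) g' j \<longleftrightarrow> g = g'"
  proof
    assume "compose (carrier (AutoGroup H)) g j = compose (carrier (AutoGroup H)) g' j"
    then have "g (j \<alpha>) = g' (j \<alpha>)" if "\<alpha> \<in> carrier (AutoGroup H)" for \<alpha>
      using that by (metis compose_eq)
    then have "g \<beta> = g' \<beta>" if "\<beta> \<in> carrier (AutoGroup G)" for \<beta>
      using g g' extension_along_j_unique[OF _ _ _ that] by (simp add: Homs_def)
    then show "g = g'" using g g' by (auto simp: Homs_def intro: extensionalityI)
  qed simp
next
  fix g assume "g \<in> Homs (AutoGroup G) (AutoGroup G)"
  then show "compose (carrier (AutoGroup H)) g j \<in> Homs (AutoGroup H) (AutoGroup G)"
    using AutH.hom_compose[OF j_hom, of g "AutoGroup G"] by (simp add: Homs_def)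
next
  fix f assume f: "f \<in> Homs (AutoGroup H) (AutoGroup G)"
  then have f_hom: "f \<in> hom (AutoGroup H) (AutoGroup G)" by (simp add: Homs_def)
  have "\<exists>g \<in> hom (AutoGroup G) (AutoGroup G). \<forall>\<alpha> \<in> carrier (AutoGroup H). g (j \<alpha>) = f \<alpha>"
    using hom_trivial_or_inj[OF f_hom] hom_extends_if_inj[OF f_hom] hom_extends_if_trivial_on_Inn[OF f_hom]
    by blast
  then obtain g where g: "g \<in> hom (AutoGroup G) (AutoGroup G)"
    and gj: "\<And>\<alpha>. \<alpha> \<in> carrier (AutoGroup H) \<Longrightarrow> g (j \<alpha>) = f \<alpha>" by blast
  have "restrict g (carrier (AutoGroup G)) \<in> Homs (AutoGroup G) (AutoGroup G)"
    using g by (auto simp: Homs_def hom_def)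
  moreover have "f = compose (carrier (AutoGroup H)) (restrict g (carrier (AutoGroup G))) j"
    using f by (intro extensionalityI[of _ "carrier (AutoGroup H)"]) (auto simp: Homs_def compose_def gj)
  ultimately show "\<exists>g \<in> Homs (AutoGroup G) (AutoGroup G). f = compose (carrier (AutoGroup H)) g j"
    by blast
qed

end

theorem theorem2p4:
  fixes H :: "('a, 'm) monoid_scheme" and G :: "('b, 'n) monoid_scheme" and i :: "'a \<Rightarrow> 'b"
  assumes "simple_group H" "finite (carrier H)" "\<not> comm_group H"
    and "simple_group G" "finite (carrier G)" "\<not> comm_group G"
    and "i \<in> mon H G" "localization H G i"
  shows "(\<exists>j \<in> mon (AutoGroup H) (AutoGroup G). extends_to_Aut H G i j) \<and>
    (\<forall>j \<in> mon (AutoGroup H) (AutoGroup G).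
      extends_to_Aut H G i j \<longrightarrow> Out_map G j \<in> iso (Out H) (Out G) \<longrightarrow>
      localization (AutoGroup H) (AutoGroup G) j)"
proof -
  interpret simple_group_localization H G i
    using assms by (simp add: simple_group_localization_def simple_group_localization_axioms_def)
  have "localization (AutoGroup H) (AutoGroup G) j"
    if "j \<in> mon (AutoGroup H) (AutoGroup G)" "extends_to_Aut H G i j" "Out_map G j \<in> iso (Out H) (Out G)" for j
  proof -
    interpret Out_iso_extension H G i j
      using that by unfold_locales (auto simp: mon_def)
    show ?thesis by (rule localization_j)
  qed
  then show ?thesis using ex_AutoGroup_extension by blast
qed

end
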